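(* Let $a<b$ be real numbers, let $f:[a,b]\rightarrow\mathbb{R}$ be bounded, let $p\geq1$ and let $x_1<\cdots<x_p$ be $p$ points in $]a,b[$; put $x_0=a$ and $x_{p+1}=b$. Let $F:[a,b]\rightarrow\mathbb{R}$ be a function (not necessarily monotone) which is discontinuous only at the points $x_1,\dots,x_p$, with discontinuity jumps $p_h=F(x_h+0)-F(x_h-0)$, $1\leq h\leq p$. (1) Suppose that $F$ is constant on each open interval $]x_{h-1},x_h[$, $1\leq h\leq p+1$. If $f$ is continuous at each $x_h$, $h\in\{1,\dots,p\}$, then every sequence of Riemann-Stieltjes sums $S(\pi_n,c_n,f,F)$ on $[a,b]$ with number of subdivision intervals $\ell(n)\rightarrow+\infty$ and modulus $p(\pi_n)\rightarrow0$ converges, as $n\rightarrow+\infty$, to $$I(f,F)=\{F(a+0)-F(a)\}f(a)+\{F(b)-F(b-0)\}f(b)+\sum_{h=1}^{p}p_hf(x_h),$$ which is, by definition, the Riemann-Stieltjes integral $\int_a^b f(x)\,dF(x)$. (2) Suppose instead of constancy that $F$ is merely continuous on each open interval $]x_{h-1},x_h[$, $1\leq h\leq p+1$. If $f$ is continuous at each $x_h$, $h\in\{1,\dots,p\}$, and is almost-surely continuous on each $]x_{h-1},x_h[$, $1\leq h\leq p+1$, then the Riemann-Stieltjes integral of $f$ with respect to $F$ on $[a,b]$ exists and $$\int_a^b f(x)\,dF(x)=\{F(a+0)-F(a)\}f(a)+\{F(b)-F(b-0)\}f(b)+\sum_{h=1}^{p}p_hf(x_h)+\sum_{h=1}^{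p+1}\int_{x_{h-1}}^{x_h}f(x)\,dF(x).$$
   Context: Notation: $]u,v[$ is the open interval; $F(x+0)$ and $F(x-0)$ are the right-hand and left-hand limits of $F$ at $x$, assumed to exist and be finite where they are used. "Almost-surely continuous" on an interval means continuous at almost every point of it with respect to the Lebesgue measure. Riemann-Stieltjes sums: for each $n\geq1$ let $\pi_n=(a=y_{0,n}<\cdots<y_{j,n}<\cdots<y_{\ell(n)-1,n}<y_{\ell(n),n}=b)$ be a subdivision of $[a,b]$ with modulus $p(\pi_n)=\max_{0\leq j\leq\ell(n)-1}(y_{j+1,n}-y_{j,n})$, and let $c_n=(c_{j,n})_{0\leq j\leq\ell(n)-1}$ with $c_{j,n}\in\,]y_{j,n},y_{j+1,n}[$. The associated sum is $$S(\pi_n,c_n,f,F)=\sum_{0\leq j\leq\ell(n)-1}f(c_{j,n})\,(F(y_{j+1,n})-F(y_{j,n})).$$ The Riemann-Stieltjes integral $\int_a^bf(x)\,dF(x)$ exists when all such sequences of sums, with $\ell(n)\rightarrow+\infty$ and $p(\pi_n)\rightarrow0$ as $n\rightarrow+\infty$, converge to a common finite limit, which is then its value. In part (2), each $\int_{x_{h-1}}^{x_h}f(x)\,dF(x)$ denotes the Riemann-Stieltjes integral on $[x_{h-1},x_h]$ with respect to the continuous part of $F$ on $]x_{h-1},x_h[$, i.e. with respect to $F$ restricted to $]x_{h-1},x_h[$ and given at the endpoints the values $F(x_{h-1}+0)$ and $F(x_h-0)$, so that the jumps of $F$ at the endpoints are not counted in it.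
   Formalization: Part (2) additionally assumes that the Riemann-Stieltjes integrals of f over each [x_{h-1},x_h] with respect to the continuous part of F exist; almost-sure continuity of f and continuity of F alone do not ensure this (e.g. f=F=√t cos(π/t) near 0). *)

theory Defs
  imports "HOL-Analysis.Analysis"
begin

definition subdivision :: "real \<Rightarrow> real \<Rightarrow> nat \<Rightarrow> (nat \<Rightarrow> real) \<Rightarrow> bool" where
  "subdivision a b l y \<longleftrightarrow> y 0 = a \<and> y l = b \<and> (\<forall>j<l. y j < y (Suc j))"

definition tags :: "nat \<Rightarrow> (nat \<Rightarrow> real) \<Rightarrow> (nat \<Rightarrow> real) \<Rightarrow> bool" where
  "tags l y c \<longleftrightarrow> (\<forall>j<l. c j \<in> {y j<..<y (Suc j)})"

definition modulus :: "nat \<Rightarrow> (nat \<Rightarrow> real) \<Rightarrow> real" where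
  "modulus l y = Max ((\<lambda>j. y (Suc j) - y j) ` {..<l})"

definition rs_sum ::
  "(real \<Rightarrow> real) \<Rightarrow> (real \<Rightarrow> real) \<Rightarrow> nat \<Rightarrow> (nat \<Rightarrow> real) \<Rightarrow> (nat \<Rightarrow> real) \<Rightarrow> real" where
  "rs_sum f F l y c = (\<Sum>j<l. f (c j) * (F (y (Suc j)) - F (y j)))"

definition rs_sequence ::
  "real \<Rightarrow> real \<Rightarrow> (nat \<Rightarrow> nat) \<Rightarrow> (nat \<Rightarrow> nat \<Rightarrow> real) \<Rightarrow> (nat \<Rightarrow> nat \<Rightarrow> real) \<Rightarrow> bool" where
  "rs_sequence a b l y c \<longleftrightarrow>
     (\<forall>n\<ge>1. subdivision a b (l n) (y n) \<and> tags (l n) (y n) (c n)) \<and>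
     filterlim l at_top sequentially \<and>
     (\<lambda>n. modulus (l n) (y n)) \<longlonglongrightarrow> 0"

definition has_rs_integral ::
  "(real \<Rightarrow> real) \<Rightarrow> (real \<Rightarrow> real) \<Rightarrow> real \<Rightarrow> real \<Rightarrow> real \<Rightarrow> bool" where
  "has_rs_integral f F a b I \<longleftrightarrow>
     (\<forall>l y c. rs_sequence a b l y c \<longrightarrow> (\<lambda>n. rs_sum f F (l n) (y n) (c n)) \<longlonglongrightarrow> I)"

definition rs_integrable :: "(real \<Rightarrow> real) \<Rightarrow> (real \<Rightarrow> real) \<Rightarrow> real \<Rightarrow> real \<Rightarrow> bool" where
  "rs_integrable f F a b \<longleftrightarrow> (\<exists>I. has_rs_integral f F a b I)"

(* Meaningful only if rs_integrable f F a b and a < b; the value is then unique. *)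
definition rs_integral :: "(real \<Rightarrow> real) \<Rightarrow> (real \<Rightarrow> real) \<Rightarrow> real \<Rightarrow> real \<Rightarrow> real" where
  "rs_integral f F a b = (THE I. has_rs_integral f F a b I)"

(* F(t+0) and F(t-0); arbitrary values if the limits do not exist. *)
definition right_lim :: "(real \<Rightarrow> real) \<Rightarrow> real \<Rightarrow> real" where
  "right_lim F t = Lim (at_right t) F"

definition left_lim :: "(real \<Rightarrow> real) \<Rightarrow> real \<Rightarrow> real" where
  "left_lim F t = Lim (at_left t) F"

definition jump :: "(real \<Rightarrow> real) \<Rightarrow> real \<Rightarrow> real" where
  "jump F t = right_lim F t - left_lim F t"

(* F restricted to ]u,v[, with the values F(u+0) and F(v-0) at the endpoints. Only the
   values on [u,v] matter; the function is extended by constants outside. *)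
definition continuous_part ::
  "(real \<Rightarrow> real) \<Rightarrow> real \<Rightarrow> real \<Rightarrow> real \<Rightarrow> real" where
  "continuous_part F u v =
     (\<lambda>t. if t \<le> u then right_lim F u else if v \<le> t then left_lim F v else F t)"

end

theory Submission
  imports Defs
begin

text \<open>
  Everything takes place on the fixed interval \<open>[a,b]\<close>, and only the integrator is decomposed.
  The function \<open>continuous_part F u v\<close> is extended by constants outside \<open>[u,v]\<close>, so that the
  continuous parts of \<open>F\<close> on the consecutive pieces can be added up as functions on the line:
  if \<open>u < m < v\<close>, then \<open>continuous_part F u v\<close> is, up to a constant, the sum of the continuous
  parts on \<open>]u,m[\<close> and \<open>]m,v[\<close> and of two step functions located at \<open>m\<close>, a right-continuous one
  of height \<open>F(m) - F(m-0)\<close> and a left-continuous one of height \<open>F(m+0) - F(m)\<close>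
  (lemma \<open>continuous_part_split\<close>).  As the Riemann-Stieltjes integral is additive in the
  integrator, there are two things to understand.

  A unit step at \<open>m\<close> has exactly one nonzero increment along any subdivision, and the
  corresponding tag tends to \<open>m\<close>; if \<open>f\<close> is continuous at \<open>m\<close>, the integral is therefore
  \<open>f(m)\<close>, and the two steps at \<open>m\<close> together contribute the jump of \<open>F\<close> times \<open>f(m)\<close>
  (\<open>has_rs_integral_step_ge\<close>, \<open>has_rs_integral_step_gt\<close>).

  An integrator that is constant outside \<open>[u,v]\<close> has the same integral over \<open>[a,b]\<close> as over
  \<open>[u,v]\<close>.  Indeed, a subdivision of \<open>[a,b]\<close> need not contain \<open>u\<close> and \<open>v\<close>, but cutting it off
  there changes only the tags of the two intervals that contain them, and the increments of
  the integrator over these tend to zero because the continuous part is continuous at its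
  endpoints, while \<open>f\<close> is bounded (\<open>has_rs_integral_extend\<close>).

  An induction over the points of discontinuity gives \<open>has_rs_integral_jumps\<close>.  Both parts of
  the theorem are instances of it: for piecewise constant \<open>F\<close> the continuous parts are constants
  and their integrals vanish.  The terms at \<open>a\<close> and \<open>b\<close> vanish, since \<open>F\<close> is continuous there.
\<close>

section \<open>Subdivisions and a characterization of the integral by their mesh\<close>

definition fine_subdivision ::
  "real \<Rightarrow> real \<Rightarrow> real \<Rightarrow> nat \<Rightarrow> (nat \<Rightarrow> real) \<Rightarrow> (nat \<Rightarrow> real) \<Rightarrow> bool" where
  "fine_subdivision d a b l y c \<longleftrightarrow>
     subdivision a b l y \<and> tags l y c \<and> (\<forall>j<l. y (Suc j) - y j < d)"

lemma subdivision_less: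
  assumes "subdivision a b l y" "i < j" "j \<le> l"
  shows "y i < y j"
  using assms(2,3)
proof (induction j)
  case (Suc j)
  then have "y j < y (Suc j)"
    using assms(1) by (simp add: subdivision_def)
  with Suc show ?case
    by (cases "i = j") auto
qed simp

lemma subdivision_le:
  assumes "subdivision a b l y" "i \<le> j" "j \<le> l"
  shows "y i \<le> y j"
  using subdivision_less[OF assms(1), of i j] assms(2,3) by (cases "i = j") simp_all

lemma subdivision_bounds:
  assumes "subdivision a b l y" "i \<le> l"
  shows "y i \<in> {a..b}"
  using subdivision_le[OF assms(1), of 0 i] subdivision_le[OF assms(1), of i l] assms
  by (simp add: subdivision_def)

lemma tag_bounds:
  assumes "subdivision a b l y" "tags l y c" "j < l"
  shows "c j \<in> {a<..<b}"
  using subdivision_bounds[OF assms(1), of j] subdivision_bounds[OF assms(1), of "Suc j"] assms(2,3)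
  by (force simp: tags_def)

lemma subdivision_pos:
  assumes "subdivision a b l y" "a < b"
  shows "l > 0"
  using assms by (cases l) (auto simp: subdivision_def)

lemma subdivision_locate:
  assumes "subdivision a b l y" "a < m" "m \<le> b"
  obtains j where "j < l" "y j < m" "m \<le> y (Suc j)"
proof -
  define k where "k = (LEAST k. m \<le> y k)"
  have "m \<le> y l"
    using assms by (simp add: subdivision_def)
  then have k: "m \<le> y k" "k \<le> l"
    unfolding k_def by (auto intro: LeastI Least_le)
  with assms have "k \<noteq> 0"
    by (intro notI) (simp add: subdivision_def)
  then obtain j where j: "k = Suc j"
    using not0_implies_Suc by blast
  then have "y j < m"
    using not_less_Least[of j "\<lambda>k. m \<le> y k"] by (simp add: k_def)
  with j k that show thesis
    by (simp add: Suc_le_eq)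
qed

lemma subdivision_length_le:
  assumes "subdivision a b l y" "\<And>j. j < l \<Longrightarrow> y (Suc j) - y j \<le> d"
  shows "b - a \<le> real l * d"
proof -
  have "b - a = (\<Sum>j<l. y (Suc j) - y j)"
    using assms(1) by (simp add: subdivision_def sum_lessThan_telescope)
  also have "\<dots> \<le> (\<Sum>j<l. d)"
    using assms(2) by (intro sum_mono) simp
  finally show ?thesis
    by simp
qed

lemma fine_subdivision_exists:
  assumes "a < b" "d > 0"
  obtains l y c where "fine_subdivision d a b l y c"
proof -
  obtain l :: nat where l: "(b - a) / d < real l"
    using reals_Archimedean2 by blast
  have "0 < (b - a) / d"
    using assms by simp
  with l have "real l > 0"
    by linarith
  define y where "y i = a + real i * ((b - a) / real l)" for i
  have step: "y (Suc i) - y i = (b - a) / real l" for i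
    by (simp add: y_def distrib_right add_divide_distrib)
  have pos: "(b - a) / real l > 0"
    using assms \<open>real l > 0\<close> by simp
  have "(b - a) / real l < d"
    using l assms \<open>real l > 0\<close> by (simp add: field_simps)
  moreover have "y 0 = a" "y l = b"
    using \<open>real l > 0\<close> by (simp_all add: y_def)
  moreover have lt: "y i < y (Suc i)" for i
    using step[of i] pos by linarith
  ultimately have "fine_subdivision d a b l y (\<lambda>i. (y i + y (Suc i)) / 2)"
    using step by (simp add: fine_subdivision_def subdivision_def tags_def)
  with that show thesis .
qed

text \<open>
  The mesh alone controls convergence.  For the forward implication, a failure of the
  right-hand side yields for each \<open>n\<close> a bad subdivision of mesh below \<open>1/(n+1)\<close>; its number of
  intervals is then at least \<open>(b-a)(n+1)\<close>, so these subdivisions form an admissible sequence.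
\<close>

lemma has_rs_integral_iff:
  assumes "a < b"
  shows "has_rs_integral f F a b I \<longleftrightarrow>
    (\<forall>e>0. \<exists>d>0. \<forall>l y c. fine_subdivision d a b l y c \<longrightarrow> \<bar>rs_sum f F l y c - I\<bar> < e)"
    (is "_ \<longleftrightarrow> ?R")
proof
  assume H: "has_rs_integral f F a b I"
  show ?R
  proof (rule ccontr)
    assume "\<not> ?R"
    then obtain e where e: "e > 0" and not_fine_enough:
        "\<not> (\<exists>d>0. \<forall>l y c. fine_subdivision d a b l y c \<longrightarrow> \<bar>rs_sum f F l y c - I\<bar> < e)"
      by (simp only: not_all not_imp) (elim exE conjE)
    have "\<forall>n. \<exists>l y c. fine_subdivision (1 / real (Suc n)) a b l y c \<and>
        \<not> \<bar>rs_sum f F l y c - I\<bar> < e"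
    proof
      fix n
      have "1 / real (Suc n) > 0"
        by simp
      with not_fine_enough show "\<exists>l y c. fine_subdivision (1 / real (Suc n)) a b l y c \<and>
          \<not> \<bar>rs_sum f F l y c - I\<bar> < e"
        by (simp only: not_ex not_all not_imp de_Morgan_conj) (elim allE[of _ "1 / real (Suc n)"], simp)
    qed
    then obtain l y c where
      fine: "\<And>n. fine_subdivision (1 / real (Suc n)) a b (l n) (y n) (c n)" and
      far: "\<And>n. \<not> \<bar>rs_sum f F (l n) (y n) (c n) - I\<bar> < e"
      by metis
    have sub: "subdivision a b (l n) (y n)" and tag: "tags (l n) (y n) (c n)"
      and mesh: "\<And>j. j < l n \<Longrightarrow> y n (Suc j) - y n j < 1 / real (Suc n)" for n
      using fine[of n] by (auto simp: fine_subdivision_def)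
    have lpos: "l n > 0" for n
      using subdivision_pos[OF sub assms] .
    have length: "real n * (b - a) \<le> real (l n)" for n
    proof -
      have "b - a \<le> real (l n) * (1 / real (Suc n))"
        using mesh by (intro subdivision_length_le[OF sub]) (simp add: less_imp_le)
      then have "(b - a) * real (Suc n) \<le> real (l n)"
        by (simp add: field_simps)
      moreover have "real n * (b - a) \<le> (b - a) * real (Suc n)"
        using assms by (simp add: algebra_simps)
      ultimately show ?thesis
        by linarith
    qed
    have "filterlim (\<lambda>n. real n * (b - a)) at_top sequentially"
      using assms
      by (intro filterlim_at_top_mult_tendsto_pos[OF tendsto_const])
        (auto intro: filterlim_real_sequentially)
    then have "filterlim (\<lambda>n. real (l n)) at_top sequentially"
      by (rule filterlim_at_top_mono) (simp add: length)
    then have "filterlim l at_top sequentially"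
      by (simp add: filterlim_sequentially_iff_filterlim_real)
    moreover have "(\<lambda>n. modulus (l n) (y n)) \<longlonglongrightarrow> 0"
    proof (rule tendsto_sandwich[OF _ _ tendsto_const LIMSEQ_inverse_real_of_nat])
      show "\<forall>\<^sub>F n in sequentially. 0 \<le> modulus (l n) (y n)"
      proof (intro always_eventually allI)
        fix n
        have "0 \<le> y n (Suc 0) - y n 0"
          using subdivision_le[OF sub, of 0 "Suc 0" n] lpos[of n] by simp
        also have "\<dots> \<le> modulus (l n) (y n)"
          unfolding modulus_def using lpos by (intro Max_ge) auto
        finally show "0 \<le> modulus (l n) (y n)" .
      qed
      show "\<forall>\<^sub>F n in sequentially. modulus (l n) (y n) \<le> inverse (real (Suc n))"
        unfolding modulus_def using lpos mesh
        by (intro always_eventually allI Max.boundedI)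
          (auto simp: inverse_eq_divide intro!: less_imp_le)
    qed
    ultimately have "rs_sequence a b l y c"
      using sub tag by (simp add: rs_sequence_def)
    with H have "(\<lambda>n. rs_sum f F (l n) (y n) (c n)) \<longlonglongrightarrow> I"
      by (simp add: has_rs_integral_def)
    from tendstoD[OF this e] have "\<forall>\<^sub>F n in sequentially. \<bar>rs_sum f F (l n) (y n) (c n) - I\<bar> < e"
      by (simp add: dist_real_def)
    with far show False
      by simp
  qed
next
  assume R: ?R
  show "has_rs_integral f F a b I"
    unfolding has_rs_integral_def
  proof (intro allI impI tendstoI)
    fix l y c and e :: real
    assume seq: "rs_sequence a b l y c" and "e > 0"
    with R obtain d where "d > 0"
      and d: "\<And>l y c. fine_subdivision d a b l y c \<Longrightarrow> \<bar>rs_sum f F l y c - I\<bar> < e"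
      by blast
    from seq have "(\<lambda>n. modulus (l n) (y n)) \<longlonglongrightarrow> 0"
      by (simp add: rs_sequence_def)
    from order_tendstoD(2)[OF this \<open>d > 0\<close>] eventually_ge_at_top[of 1]
    show "\<forall>\<^sub>F n in sequentially. dist (rs_sum f F (l n) (y n) (c n)) I < e"
    proof eventually_elim
      case (elim n)
      have sub: "subdivision a b (l n) (y n)" and "tags (l n) (y n) (c n)"
        using seq elim by (auto simp: rs_sequence_def)
      moreover have "y n (Suc j) - y n j < d" if "j < l n" for j
      proof -
        have "y n (Suc j) - y n j \<le> modulus (l n) (y n)"
          unfolding modulus_def using that by (intro Max_ge) auto
        with elim show ?thesis
          by linarith
      qed
      ultimately have "fine_subdivision d a b (l n) (y n) (c n)"
        by (simp add: fine_subdivision_def)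
      from d[OF this] show ?case
        by (simp add: dist_real_def)
    qed
  qed
qed

lemma has_rs_integralE:
  assumes "has_rs_integral f F a b I" "a < b" "e > 0"
  obtains d where "d > 0"
    and "\<And>l y c. fine_subdivision d a b l y c \<Longrightarrow> \<bar>rs_sum f F l y c - I\<bar> < e"
  using assms(1,3) unfolding has_rs_integral_iff[OF assms(2)] by blast

section \<open>Elementary properties of the integral\<close>

lemma has_rs_integral_unique:
  assumes "a < b" "has_rs_integral f F a b I" "has_rs_integral f F a b J"
  shows "I = J"
proof (rule ccontr)
  assume "I \<noteq> J"
  define e where "e = \<bar>I - J\<bar> / 2"
  have "e > 0"
    using \<open>I \<noteq> J\<close> by (simp add: e_def)
  obtain d where "d > 0"
    and d: "\<And>l y c. fine_subdivision d a b l y c \<Longrightarrow> \<bar>rs_sum f F l y c - I\<bar> < e"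
    using has_rs_integralE[OF assms(2,1) \<open>e > 0\<close>] by blast
  obtain d' where "d' > 0"
    and d': "\<And>l y c. fine_subdivision d' a b l y c \<Longrightarrow> \<bar>rs_sum f F l y c - J\<bar> < e"
    using has_rs_integralE[OF assms(3,1) \<open>e > 0\<close>] by blast
  obtain l y c where "fine_subdivision (min d d') a b l y c"
    using fine_subdivision_exists[OF assms(1), of "min d d'"] \<open>d > 0\<close> \<open>d' > 0\<close> by auto
  then have "fine_subdivision d a b l y c" "fine_subdivision d' a b l y c"
    by (auto simp: fine_subdivision_def)
  from d[OF this(1)] d'[OF this(2)] have "\<bar>I - J\<bar> < 2 * e"
    by linarith
  then show False
    by (simp add: e_def)
qed

lemma rs_integral_eqI:
  assumes "a < b" "has_rs_integral f F a b I"
  shows "rs_integral f F a b = I"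
  unfolding rs_integral_def using assms has_rs_integral_unique by blast

lemma rs_integrable_imp_has_rs_integral:
  assumes "a < b" "rs_integrable f F a b"
  shows "has_rs_integral f F a b (rs_integral f F a b)"
  using assms rs_integral_eqI by (fastforce simp: rs_integrable_def)

lemma has_rs_integral_const: "has_rs_integral f (\<lambda>t. k) a b 0"
  by (simp add: has_rs_integral_def rs_sum_def)

lemma has_rs_integral_add:
  assumes "has_rs_integral f F a b I" "has_rs_integral f G a b J"
  shows "has_rs_integral f (\<lambda>t. F t + G t) a b (I + J)"
proof -
  have "rs_sum f (\<lambda>t. F t + G t) l y c = rs_sum f F l y c + rs_sum f G l y c" for l y c
    by (simp add: rs_sum_def sum.distrib[symmetric] algebra_simps)
  with assms show ?thesis
    by (simp add: has_rs_integral_def tendsto_add)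
qed

lemma has_rs_integral_cmult:
  assumes "has_rs_integral f F a b I"
  shows "has_rs_integral f (\<lambda>t. k * F t) a b (k * I)"
proof -
  have "rs_sum f (\<lambda>t. k * F t) l y c = k * rs_sum f F l y c" for l y c
    by (simp add: rs_sum_def sum_distrib_left algebra_simps)
  with assms show ?thesis
    by (simp add: has_rs_integral_def tendsto_mult_left)
qed

lemma has_rs_integral_cong:
  assumes "a < b" "\<And>t. t \<in> {a..b} \<Longrightarrow> F t = G t" "has_rs_integral f F a b I"
  shows "has_rs_integral f G a b I"
proof -
  have "rs_sum f G l y c = rs_sum f F l y c" if "fine_subdivision d a b l y c" for d l y c
  proof -
    have "F (y i) = G (y i)" if "i \<le> l" for i
      using assms(2) subdivision_bounds that \<open>fine_subdivision d a b l y c\<close>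
      unfolding fine_subdivision_def by blast
    then show ?thesis
      unfolding rs_sum_def by (intro sum.cong) auto
  qed
  with assms show ?thesis
    unfolding has_rs_integral_iff[OF assms(1)] by metis
qed

text \<open>
  The reflection \<open>t \<mapsto> -t\<close> reverses subdivisions and hence the sign of all increments.  It
  transfers statements about right endpoints and right-continuous steps to their mirror images.
\<close>

lemma has_rs_integral_reflect:
  assumes "a < b" "has_rs_integral f F a b I"
  shows "has_rs_integral (\<lambda>t. f (- t)) (\<lambda>t. F (- t)) (- b) (- a) (- I)"
  unfolding has_rs_integral_iff[of "- b" "- a", unfolded neg_less_iff_less, OF assms(1)]
proof (intro allI impI)
  fix e :: real assume "e > 0"
  then obtain d where "d > 0"
    and d: "\<And>l y c. fine_subdivision d a b l y c \<Longrightarrow> \<bar>rs_sum f F l y c - I\<bar> < e"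
    using has_rs_integralE[OF assms(2,1)] by blast
  have "\<bar>rs_sum (\<lambda>t. f (- t)) (\<lambda>t. F (- t)) l y c - - I\<bar> < e"
    if fine: "fine_subdivision d (- b) (- a) l y c" for l y c
  proof -
    define y' where "y' i = - y (l - i)" for i
    define c' where "c' i = - c (l - Suc i)" for i
    have sub: "subdivision (- b) (- a) l y" and tag: "tags l y c"
      and mesh: "\<And>j. j < l \<Longrightarrow> y (Suc j) - y j < d"
      using fine by (auto simp: fine_subdivision_def)
    have flip: "y' i = - y (Suc (l - Suc i))" "y' (Suc i) = - y (l - Suc i)" if "i < l" for i
      using that by (auto simp: y'_def Suc_diff_Suc)
    have "fine_subdivision d a b l y' c'"
      unfolding fine_subdivision_def subdivision_def tags_def
    proof (intro conjI allI impI)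
      show "y' 0 = a" "y' l = b"
        using sub by (auto simp: y'_def subdivision_def)
      fix j assume "j < l"
      then have *: "l - Suc j < l"
        by simp
      show "y' j < y' (Suc j)"
        using sub * flip[OF \<open>j < l\<close>] by (simp add: subdivision_def)
      show "c' j \<in> {y' j<..<y' (Suc j)}"
        using tag * flip[OF \<open>j < l\<close>] by (simp add: tags_def c'_def)
      show "y' (Suc j) - y' j < d"
        using mesh[OF *] flip[OF \<open>j < l\<close>] by simp
    qed
    from d[OF this] have "\<bar>rs_sum f F l y' c' - I\<bar> < e" .
    moreover have "rs_sum f F l y' c' = - rs_sum (\<lambda>t. f (- t)) (\<lambda>t. F (- t)) l y c"
    proof -
      have "rs_sum f F l y' c' =
          (\<Sum>i<l. f (- c (l - Suc i)) * (F (- y (l - Suc i)) - F (- y (Suc (l - Suc i)))))"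
        unfolding rs_sum_def by (intro sum.cong) (auto simp: flip c'_def)
      also have "\<dots> = (\<Sum>i<l. f (- c i) * (F (- y i) - F (- y (Suc i))))"
        by (rule sum.nat_diff_reindex)
      also have "\<dots> = - rs_sum (\<lambda>t. f (- t)) (\<lambda>t. F (- t)) l y c"
        by (simp add: rs_sum_def sum_negf[symmetric] algebra_simps)
      finally show ?thesis .
    qed
    ultimately show ?thesis
      by simp
  qed
  with \<open>d > 0\<close> show "\<exists>d>0. \<forall>l y c. fine_subdivision d (- b) (- a) l y c \<longrightarrow>
      \<bar>rs_sum (\<lambda>t. f (- t)) (\<lambda>t. F (- t)) l y c - - I\<bar> < e"
    by blast
qed

section \<open>Step functions as integrators\<close>

text \<open>
  Only the interval that contains \<open>m\<close> as an inner point or as its right endpoint contributes,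
  and its tag is closer to \<open>m\<close> than the mesh.
\<close>

lemma has_rs_integral_step_ge:
  assumes "a < m" "m \<le> b" "continuous (at m within {a..b}) f"
  shows "has_rs_integral f (\<lambda>t. if m \<le> t then 1 else 0) a b (f m)"
proof -
  have "a < b"
    using assms by simp
  show ?thesis
    unfolding has_rs_integral_iff[OF \<open>a < b\<close>]
  proof (intro allI impI)
    fix e :: real assume "e > 0"
    with assms(3) obtain d where "d > 0"
      and d: "\<And>t. t \<in> {a..b} \<Longrightarrow> \<bar>t - m\<bar> < d \<Longrightarrow> \<bar>f t - f m\<bar> < e"
      unfolding continuous_within_eps_delta dist_real_def by blast
    have "\<bar>rs_sum f (\<lambda>t. if m \<le> t then 1 else 0) l y c - f m\<bar> < e"
      if fine: "fine_subdivision d a b l y c" for l y c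
    proof -
      have sub: "subdivision a b l y" and tag: "tags l y c"
        and mesh: "\<And>j. j < l \<Longrightarrow> y (Suc j) - y j < d"
        using fine by (auto simp: fine_subdivision_def)
      obtain j where j: "j < l" "y j < m" "m \<le> y (Suc j)"
        using subdivision_locate[OF sub assms(1,2)] .
      have below: "y i < m" if "i \<le> j" for i
        using subdivision_le[OF sub that] j by simp
      have above: "m \<le> y i" if "j < i" "i \<le> l" for i
        using subdivision_le[OF sub, of "Suc j" i] j that by simp
      have "rs_sum f (\<lambda>t. if m \<le> t then 1 else 0) l y c = (\<Sum>i<l. if i = j then f (c j) else 0)"
        unfolding rs_sum_def
      proof (intro sum.cong refl)
        fix i assume "i \<in> {..<l}"
        then show "f (c i) * ((if m \<le> y (Suc i) then 1 else 0) - (if m \<le> y i then 1 else 0))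
            = (if i = j then f (c j) else 0)"
          using below[of i] below[of "Suc i"] above[of i] above[of "Suc i"] j
          by (cases i j rule: linorder_cases) auto
      qed
      then have "rs_sum f (\<lambda>t. if m \<le> t then 1 else 0) l y c = f (c j)"
        using j by simp
      moreover have "c j \<in> {a..b}"
        using tag_bounds[OF sub tag j(1)] by simp
      moreover have "\<bar>c j - m\<bar> < d"
        using tag j mesh[OF j(1)] unfolding tags_def by (auto simp: abs_if)
      ultimately show ?thesis
        using d by simp
    qed
    with \<open>d > 0\<close> show "\<exists>d>0. \<forall>l y c. fine_subdivision d a b l y c \<longrightarrow>
        \<bar>rs_sum f (\<lambda>t. if m \<le> t then 1 else 0) l y c - f m\<bar> < e"
      by blast
  qed
qed

lemma continuous_within_reflect:
  fixes f :: "real \<Rightarrow> real"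
  assumes "continuous (at m within {a..b}) f"
  shows "continuous (at (- m) within {- b..- a}) (\<lambda>t. f (- t))"
proof -
  have img: "uminus ` {- b..- a} = {a..b}"
    by simp
  have "continuous (at (- m) within {- b..- a}) (f \<circ> uminus)"
    by (rule continuous_within_compose) (use assms img in \<open>auto intro: continuous_intros\<close>)
  then show ?thesis
    by (simp add: o_def)
qed

lemma has_rs_integral_step_gt:
  assumes "a \<le> m" "m < b" "continuous (at m within {a..b}) f"
  shows "has_rs_integral f (\<lambda>t. if m < t then 1 else 0) a b (f m)"
proof -
  have "has_rs_integral (\<lambda>t. f (- t)) (\<lambda>t. if - m \<le> t then 1 else 0) (- b) (- a) (f (- (- m)))"
    using assms by (intro has_rs_integral_step_ge continuous_within_reflect) auto
  from has_rs_integral_reflect[OF _ this] assms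
  have "has_rs_integral f (\<lambda>t. if t \<le> m then 1 else 0) a b (- f m)"
    by simp
  from has_rs_integral_add[OF has_rs_integral_const[of f 1] has_rs_integral_cmult[OF this, of "- 1"]]
  have "has_rs_integral f (\<lambda>t. 1 + - 1 * (if t \<le> m then 1 else 0)) a b (f m)"
    by simp
  moreover have "(\<lambda>t. 1 + - 1 * (if t \<le> m then 1 else 0)) = (\<lambda>t. if m < t then 1 else (0 :: real))"
    by auto
  ultimately show ?thesis
    by simp
qed

section \<open>Integrators that are constant outside an interval\<close>

text \<open>
  A subdivision of \<open>[u,b]\<close> is cut off at \<open>v\<close>.  The interval \<open>]y\<^sub>j, v[\<close> created in this way may
  not contain the old tag \<open>c\<^sub>j\<close> and receives its midpoint instead; this changes the sum by
  \<open>(f(c\<^sub>j) - f(c'\<^sub>j)) (G(v) - G(y\<^sub>j))\<close>, which is small because \<open>G\<close> is left-continuous at \<open>v\<close>.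
\<close>

lemma has_rs_integral_extend_right:
  assumes "u < v" "v \<le> b" "bounded (f ` {u..b})"
    and lim: "(G \<longlongrightarrow> G v) (at_left v)"
    and const: "\<And>t. v \<le> t \<Longrightarrow> t \<le> b \<Longrightarrow> G t = G v"
    and int: "has_rs_integral f G u v I"
  shows "has_rs_integral f G u b I"
proof -
  have "u < b"
    using assms(1,2) by simp
  obtain B where "B > 0" and B: "\<And>t. t \<in> {u..b} \<Longrightarrow> \<bar>f t\<bar> \<le> B"
    using assms(3) unfolding bounded_pos by auto
  show ?thesis
    unfolding has_rs_integral_iff[OF \<open>u < b\<close>]
  proof (intro allI impI)
    fix e :: real assume "e > 0"
    then obtain d1 where "d1 > 0"
      and d1: "\<And>l y c. fine_subdivision d1 u v l y c \<Longrightarrow> \<bar>rs_sum f G l y c - I\<bar> < e / 2"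
      using has_rs_integralE[OF int \<open>u < v\<close> half_gt_zero] by blast
    have "\<forall>\<^sub>F t in at_left v. dist (G t) (G v) < e / (4 * B)"
      using \<open>e > 0\<close> \<open>B > 0\<close> by (intro tendstoD[OF lim]) simp
    then obtain w where "w < v" and w: "\<And>t. w < t \<Longrightarrow> t < v \<Longrightarrow> \<bar>G t - G v\<bar> < e / (4 * B)"
      unfolding eventually_at_left_field dist_real_def by blast
    define d where "d = min d1 (v - w)"
    have "d > 0"
      using \<open>d1 > 0\<close> \<open>w < v\<close> by (simp add: d_def)
    have "\<bar>rs_sum f G l y c - I\<bar> < e" if fine: "fine_subdivision d u b l y c" for l y c
    proof -
      have sub: "subdivision u b l y" and tag: "tags l y c"
        and mesh: "\<And>j. j < l \<Longrightarrow> y (Suc j) - y j < d"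
        using fine by (auto simp: fine_subdivision_def)
      obtain j where j: "j < l" "y j < v" "v \<le> y (Suc j)"
        using subdivision_locate[OF sub assms(1,2)] .
      define y' where "y' = y(Suc j := v)"
      define c' where "c' = c(j := (y j + v) / 2)"
      have "fine_subdivision d1 u v (Suc j) y' c'"
        unfolding fine_subdivision_def subdivision_def tags_def
      proof (intro conjI allI impI)
        show "y' 0 = u" "y' (Suc j) = v"
          using sub by (auto simp: y'_def subdivision_def)
        fix i assume "i < Suc j"
        then have i: "i < j \<or> i = j" "i < l"
          using j by auto
        show "y' i < y' (Suc i)"
          using i j sub by (auto simp: y'_def subdivision_def)
        show "c' i \<in> {y' i<..<y' (Suc i)}"
          using i j tag by (auto simp: y'_def c'_def tags_def)
        show "y' (Suc i) - y' i < d1"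
          using i j mesh[of i] by (auto simp: y'_def d_def)
      qed
      from d1[OF this] have cut: "\<bar>rs_sum f G (Suc j) y' c' - I\<bar> < e / 2" .

      have Gv: "G (y i) = G v" if "Suc j \<le> i" "i \<le> l" for i
        using subdivision_le[OF sub that] subdivision_bounds[OF sub that(2)] j
        by (intro const) auto
      have "rs_sum f G l y c = (\<Sum>i<Suc j. f (c i) * (G (y (Suc i)) - G (y i)))"
        unfolding rs_sum_def using Gv j by (intro sum.mono_neutral_right) auto
      also have "\<dots> = (\<Sum>i<j. f (c i) * (G (y (Suc i)) - G (y i))) + f (c j) * (G v - G (y j))"
        using Gv[of "Suc j"] j by simp
      moreover have "rs_sum f G (Suc j) y' c' =
          (\<Sum>i<j. f (c i) * (G (y (Suc i)) - G (y i))) + f (c' j) * (G v - G (y j))"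
        unfolding rs_sum_def by (simp add: y'_def c'_def)
      ultimately have
        "rs_sum f G l y c - rs_sum f G (Suc j) y' c' = (f (c j) - f (c' j)) * (G v - G (y j))"
        by (simp add: algebra_simps)
      moreover have "\<bar>(f (c j) - f (c' j)) * (G v - G (y j))\<bar> \<le> (2 * B) * (e / (4 * B))"
        unfolding abs_mult
      proof (rule mult_mono)
        have "c j \<in> {u..b}"
          using tag_bounds[OF sub tag j(1)] by simp
        moreover have "c' j \<in> {u..b}"
          using subdivision_bounds[OF sub, of j] j assms(1,2) by (simp add: c'_def)
        ultimately show "\<bar>f (c j) - f (c' j)\<bar> \<le> 2 * B"
          using B[of "c j"] B[of "c' j"] by linarith
        have "w < y j"
          using mesh[OF j(1)] j by (simp add: d_def)
        from w[OF this j(2)] show "\<bar>G v - G (y j)\<bar> \<le> e / (4 * B)"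
          by linarith
      qed (use \<open>B > 0\<close> in auto)
      moreover have "(2 * B) * (e / (4 * B)) = e / 2"
        using \<open>B > 0\<close> by (simp add: field_simps)
      ultimately show ?thesis
        using cut by linarith
    qed
    with \<open>d > 0\<close> show "\<exists>d>0. \<forall>l y c. fine_subdivision d u b l y c \<longrightarrow> \<bar>rs_sum f G l y c - I\<bar> < e"
      by blast
  qed
qed

lemma has_rs_integral_extend_left:
  assumes "u < v" "a \<le> u" "bounded (f ` {a..v})"
    and "(G \<longlongrightarrow> G u) (at_right u)"
    and const: "\<And>t. a \<le> t \<Longrightarrow> t \<le> u \<Longrightarrow> G t = G u"
    and "has_rs_integral f G u v I"
  shows "has_rs_integral f G a v I"
proof -
  have "has_rs_integral (\<lambda>t. f (- t)) (\<lambda>t. G (- t)) (- v) (- a) (- I)"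
  proof (rule has_rs_integral_extend_right)
    show "- v < - u" "- u \<le> - a"
      using assms(1,2) by auto
    have "(\<lambda>t. f (- t)) ` {- v..- a} = f ` {a..v}"
      by (simp flip: image_image[of f uminus])
    then show "bounded ((\<lambda>t. f (- t)) ` {- v..- a})"
      using assms(3) by simp
    show "((\<lambda>t. G (- t)) \<longlongrightarrow> G (- (- u))) (at_left (- u))"
      using assms(4) by (simp add: filterlim_at_left_to_right)
    show "G (- t) = G (- (- u))" if "- u \<le> t" "t \<le> - a" for t
      using const[of "- t"] that by simp
    show "has_rs_integral (\<lambda>t. f (- t)) (\<lambda>t. G (- t)) (- v) (- u) (- I)"
      using assms(1,6) by (rule has_rs_integral_reflect)
  qed
  from has_rs_integral_reflect[OF _ this] show ?thesis
    using assms(1,2) by simp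
qed

lemma has_rs_integral_extend:
  assumes "a \<le> u" "u < v" "v \<le> b" "bounded (f ` {a..b})"
    and "(G \<longlongrightarrow> G u) (at_right u)" "(G \<longlongrightarrow> G v) (at_left v)"
    and "\<And>t. t \<le> u \<Longrightarrow> G t = G u" "\<And>t. v \<le> t \<Longrightarrow> G t = G v"
    and "has_rs_integral f G u v I"
  shows "has_rs_integral f G a b I"
proof (rule has_rs_integral_extend_left)
  show "has_rs_integral f G u b I"
  proof (rule has_rs_integral_extend_right)
    show "bounded (f ` {u..b})"
      using assms(1) by (intro bounded_subset[OF assms(4)]) auto
    show "G t = G v" if "v \<le> t" "t \<le> b" for t
      using assms(8) that(1) .
  qed (fact assms)+
  show "u < b"
    using assms(2,3) by simp
  show "G t = G u" if "a \<le> t" "t \<le> u" for t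
    using assms(7) that(2) .
qed (fact assms)+

section \<open>Decomposition of the integrator\<close>

lemma right_lim_eqI: "(F \<longlongrightarrow> L) (at_right t) \<Longrightarrow> right_lim F t = L"
  unfolding right_lim_def by (rule tendsto_Lim) auto

lemma left_lim_eqI: "(F \<longlongrightarrow> L) (at_left t) \<Longrightarrow> left_lim F t = L"
  unfolding left_lim_def by (rule tendsto_Lim) auto

lemma tendsto_continuous_part_right:
  assumes "u < v" "(F \<longlongrightarrow> L) (at_right u)"
  shows "(continuous_part F u v \<longlongrightarrow> continuous_part F u v u) (at_right u)"
proof -
  have "\<forall>\<^sub>F t in at_right u. F t = continuous_part F u v t"
    using eventually_at_right_less[of u] eventually_at_right_real[OF assms(1)]
    by eventually_elim (auto simp: continuous_part_def)
  with assms(2) have "(continuous_part F u v \<longlongrightarrow> L) (at_right u)"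
    by (rule Lim_transform_eventually)
  then show ?thesis
    using right_lim_eqI[OF assms(2)] by (simp add: continuous_part_def)
qed

lemma tendsto_continuous_part_left:
  assumes "u < v" "(F \<longlongrightarrow> L) (at_left v)"
  shows "(continuous_part F u v \<longlongrightarrow> continuous_part F u v v) (at_left v)"
proof -
  have "\<forall>\<^sub>F t in at_left v. F t = continuous_part F u v t"
    using eventually_at_left_real[OF assms(1)]
    by eventually_elim (auto simp: continuous_part_def)
  with assms(2) have "(continuous_part F u v \<longlongrightarrow> L) (at_left v)"
    by (rule Lim_transform_eventually)
  then show ?thesis
    using left_lim_eqI[OF assms(2)] assms(1) by (simp add: continuous_part_def)
qed

lemma has_rs_integral_continuous_part_extend:
  assumes "a \<le> u" "u < v" "v \<le> b" "bounded (f ` {a..b})"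
    and "(F \<longlongrightarrow> R) (at_right u)" "(F \<longlongrightarrow> L) (at_left v)"
    and "has_rs_integral f (continuous_part F u v) u v I"
  shows "has_rs_integral f (continuous_part F u v) a b I"
proof (rule has_rs_integral_extend)
  show "continuous_part F u v t = continuous_part F u v u" if "t \<le> u" for t
    using that by (simp add: continuous_part_def)
  show "continuous_part F u v t = continuous_part F u v v" if "v \<le> t" for t
    using that assms(2) by (simp add: continuous_part_def)
qed (fact assms tendsto_continuous_part_right[OF assms(2,5)]
      tendsto_continuous_part_left[OF assms(2,6)])+

lemma continuous_part_split:
  assumes "u < m" "m < v"
  shows "continuous_part F u v t =
    continuous_part F u m t + (continuous_part F m v t + - right_lim F m)
    + ((F m - left_lim F m) * (if m \<le> t then 1 else 0)
       + (right_lim F m - F m) * (if m < t then 1 else 0))"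
  using assms by (cases t m rule: linorder_cases) (auto simp: continuous_part_def)

lemma continuous_part_constant:
  assumes "u < v" "F constant_on {u<..<v}"
  obtains k where "continuous_part F u v = (\<lambda>t. k)"
proof -
  obtain k where k: "\<And>t. u < t \<Longrightarrow> t < v \<Longrightarrow> F t = k"
    using assms(2) by (auto simp: constant_on_def)
  have "(F \<longlongrightarrow> k) (at_right u)"
    using eventually_at_right_real[OF assms(1)]
    by (intro tendsto_eventually) (auto elim!: eventually_mono simp: k)
  moreover have "(F \<longlongrightarrow> k) (at_left v)"
    using eventually_at_left_real[OF assms(1)]
    by (intro tendsto_eventually) (auto elim!: eventually_mono simp: k)
  ultimately have "continuous_part F u v = (\<lambda>t. k)"
    by (auto simp: continuous_part_def fun_eq_iff right_lim_eqI left_lim_eqI k)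
  with that show thesis .
qed

text \<open>
  The induction runs over the integrators \<open>continuous_part F a (x k)\<close>, all of them considered
  on the whole of \<open>[a,b]\<close>.  They ignore the jump at \<open>x k\<close>, and passing from \<open>k\<close> to \<open>k + 1\<close> adds
  this jump and the continuous part of \<open>F\<close> on the next piece.  The last one is \<open>F\<close> itself
  on \<open>[a,b]\<close>.
\<close>

lemma has_rs_integral_jumps:
  fixes x :: "nat \<Rightarrow> real"
  assumes mono: "\<And>h. h \<le> p \<Longrightarrow> x h < x (Suc h)"
    and ends: "x 0 = a" "x (Suc p) = b"
    and bdd: "bounded (f ` {a..b})"
    and contf: "\<And>h. h \<in> {1..p} \<Longrightarrow> continuous (at (x h) within {a..b}) f"
    and limr: "\<And>h. h \<le> p \<Longrightarrow> \<exists>L. (F \<longlongrightarrow> L) (at_right (x h))"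
    and liml: "\<And>h. h \<le> p \<Longrightarrow> \<exists>L. (F \<longlongrightarrow> L) (at_left (x (Suc h)))"
    and Fa: "right_lim F a = F a" and Fb: "left_lim F b = F b"
    and int: "\<And>h. h \<in> {1..p+1} \<Longrightarrow>
      has_rs_integral f (continuous_part F (x (h - 1)) (x h)) (x (h - 1)) (x h) (I h)"
  shows "has_rs_integral f F a b ((\<Sum>h=1..p. jump F (x h) * f (x h)) + (\<Sum>h=1..p+1. I h))"
proof -
  have less: "x i < x j" if "i < j" "j \<le> Suc p" for i j
    using that
  proof (induction j)
    case (Suc j)
    then show ?case
      using mono[of j] by (cases "i = j") auto
  qed simp
  have range: "x i \<in> {a..b}" if "i \<le> Suc p" for i
    using that less[of 0 i] less[of i "Suc p"] ends by (cases "i = 0"; cases "i = Suc p") auto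
  have piece: "has_rs_integral f (continuous_part F (x h) (x (Suc h))) a b (I (Suc h))"
    if "h \<le> p" for h
  proof -
    obtain R L where "(F \<longlongrightarrow> R) (at_right (x h))" "(F \<longlongrightarrow> L) (at_left (x (Suc h)))"
      using limr liml \<open>h \<le> p\<close> by blast
    moreover have "a \<le> x h" "x (Suc h) \<le> b"
      using range[of h] range[of "Suc h"] \<open>h \<le> p\<close> by auto
    moreover have
      "has_rs_integral f (continuous_part F (x h) (x (Suc h))) (x h) (x (Suc h)) (I (Suc h))"
      using int[of "Suc h"] \<open>h \<le> p\<close> by simp
    ultimately show ?thesis
      using has_rs_integral_continuous_part_extend mono[OF \<open>h \<le> p\<close>] bdd by blast
  qed
  have "has_rs_integral f (continuous_part F a (x (Suc n))) a b
      ((\<Sum>h=1..n. jump F (x h) * f (x h)) + (\<Sum>h=1..Suc n. I h))" if "n \<le> p" for n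
    using that
  proof (induction n)
    case 0
    then show ?case
      using piece[of 0] ends by simp
  next
    case (Suc n)
    define m where "m = x (Suc n)"
    define v where "v = x (Suc (Suc n))"
    have m: "a < m" "m < v" "m < b"
      using Suc.prems less[of 0 "Suc n"] mono[of "Suc n"] less[of "Suc n" "Suc p"] ends
      by (auto simp: m_def v_def)
    have "continuous (at m within {a..b}) f"
      using contf[of "Suc n"] Suc.prems by (simp add: m_def)
    then have steps:
      "has_rs_integral f (\<lambda>t. (F m - left_lim F m) * (if m \<le> t then 1 else 0)
         + (right_lim F m - F m) * (if m < t then 1 else 0)) a b
         ((F m - left_lim F m) * f m + (right_lim F m - F m) * f m)"
      using m by (intro has_rs_integral_add has_rs_integral_cmult
          has_rs_integral_step_ge has_rs_integral_step_gt) auto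
    have next_piece: "has_rs_integral f (\<lambda>t. continuous_part F m v t + - right_lim F m) a b
        (I (Suc (Suc n)) + 0)"
      using piece[of "Suc n"] Suc.prems
      by (intro has_rs_integral_add has_rs_integral_const) (simp add: m_def v_def)
    have "has_rs_integral f (continuous_part F a m) a b
        ((\<Sum>h=1..n. jump F (x h) * f (x h)) + (\<Sum>h=1..Suc n. I h))"
      using Suc by (simp add: m_def)
    from has_rs_integral_add[OF has_rs_integral_add[OF this next_piece] steps]
    show ?case
      unfolding continuous_part_split[OF m(1,2), symmetric]
      by (simp add: m_def v_def jump_def algebra_simps)
  qed
  from this[of p] have "has_rs_integral f (continuous_part F a b) a b
      ((\<Sum>h=1..p. jump F (x h) * f (x h)) + (\<Sum>h=1..p+1. I h))"
    using ends by simp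
  moreover have "a < b"
    using less[of 0 "Suc p"] ends by simp
  moreover have "continuous_part F a b t = F t" if "t \<in> {a..b}" for t
    using that Fa Fb by (auto simp: continuous_part_def)
  ultimately show ?thesis
    using has_rs_integral_cong by blast
qed

section \<open>The formula for finitely many jumps\<close>

theorem proposition3:
  fixes a b :: real and f F :: "real \<Rightarrow> real" and p :: nat and x :: "nat \<Rightarrow> real"
  assumes "a < b"
    and "bounded (f ` {a..b})"
    and "p \<ge> 1"
    and "strict_mono_on {1..p} x"
    and "x ` {1..p} \<subseteq> {a<..<b}"
    and "x 0 = a" and "x (p + 1) = b"
    and "\<forall>t\<in>{a..b} - x ` {1..p}. continuous (at t within {a..b}) F"
    and "\<forall>h\<in>{1..p}. (\<exists>L. (F \<longlongrightarrow> L) (at_right (x h))) \<and> (\<exists>L. (F \<longlongrightarrow> L) (at_left (x h)))"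
  shows
    "((\<forall>h\<in>{1..p+1}. F constant_on {x (h - 1)<..<x h}) \<and>
      (\<forall>h\<in>{1..p}. continuous (at (x h) within {a..b}) f)
      \<longrightarrow>
      (\<forall>l y c. rs_sequence a b l y c \<longrightarrow>
         (\<lambda>n. rs_sum f F (l n) (y n) (c n)) \<longlonglongrightarrow>
           (right_lim F a - F a) * f a + (F b - left_lim F b) * f b
           + (\<Sum>h=1..p. jump F (x h) * f (x h))) \<and>
      rs_integrable f F a b \<and>
      rs_integral f F a b =
        (right_lim F a - F a) * f a + (F b - left_lim F b) * f b
        + (\<Sum>h=1..p. jump F (x h) * f (x h)))
     \<and>
     ((\<forall>h\<in>{1..p+1}. continuous_on {x (h - 1)<..<x h} F) \<and>
      (\<forall>h\<in>{1..p}. continuous (at (x h) within {a..b}) f) \<and>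
      (\<forall>h\<in>{1..p+1}. AE t in lebesgue. t \<in> {x (h - 1)<..<x h} \<longrightarrow> isCont f t) \<and>
      (\<forall>h\<in>{1..p+1}.
         rs_integrable f (continuous_part F (x (h - 1)) (x h)) (x (h - 1)) (x h))
      \<longrightarrow>
      rs_integrable f F a b \<and>
      rs_integral f F a b =
        (right_lim F a - F a) * f a + (F b - left_lim F b) * f b
        + (\<Sum>h=1..p. jump F (x h) * f (x h))
        + (\<Sum>h=1..p+1.
             rs_integral f (continuous_part F (x (h - 1)) (x h)) (x (h - 1)) (x h)))"
proof -
  have mono: "x h < x (Suc h)" if "h \<le> p" for h
  proof -
    have inner: "x i \<in> {a<..<b}" if "i \<in> {1..p}" for i
      using assms(5) that by blast
    consider "h = 0" | "h = p" "h \<noteq> 0" | "h \<in> {1..<p}"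
      using \<open>h \<le> p\<close> by fastforce
    then show ?thesis
    proof cases
      case 1
      with inner[of 1] assms(3,6) show ?thesis
        by simp
    next
      case 2
      with inner[of p] assms(7) show ?thesis
        by simp
    next
      case 3
      then show ?thesis
        by (intro strict_mono_onD[OF assms(4)]) auto
    qed
  qed
  then have piece: "x (h - 1) < x h" if "h \<in> {1..p+1}" for h
    using that mono[of "h - 1"] by (cases h) auto
  have "a \<notin> x ` {1..p}" "b \<notin> x ` {1..p}"
    using assms(5) by auto
  then have "continuous (at a within {a..b}) F" "continuous (at b within {a..b}) F"
    using assms(1,8) by auto
  then have lima: "(F \<longlongrightarrow> F a) (at_right a)" and limb: "(F \<longlongrightarrow> F b) (at_left b)"
    using assms(1) by (simp_all add: continuous_within at_within_Icc_at_right at_within_Icc_at_left)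
  have Fa: "right_lim F a = F a" and Fb: "left_lim F b = F b"
    using lima limb by (simp_all add: right_lim_eqI left_lim_eqI)
  have limr: "\<exists>L. (F \<longlongrightarrow> L) (at_right (x h))" if "h \<le> p" for h
    using that assms(6,9) lima by (cases "h = 0") auto
  have liml: "\<exists>L. (F \<longlongrightarrow> L) (at_left (x (Suc h)))" if "h \<le> p" for h
    using that assms(7,9) limb by (cases "h = p") auto
  have main: "has_rs_integral f F a b ((\<Sum>h=1..p. jump F (x h) * f (x h)) + (\<Sum>h=1..p+1. I h))"
    if "\<forall>h\<in>{1..p}. continuous (at (x h) within {a..b}) f"
      and "\<And>h. h \<in> {1..p+1} \<Longrightarrow>
        has_rs_integral f (continuous_part F (x (h - 1)) (x h)) (x (h - 1)) (x h) (I h)" for I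
    using that assms(2,6,7) mono limr liml Fa Fb by (intro has_rs_integral_jumps) auto
  show ?thesis
  proof (intro conjI impI; (elim conjE)?)
    assume const: "\<forall>h\<in>{1..p+1}. F constant_on {x (h - 1)<..<x h}"
      and contf: "\<forall>h\<in>{1..p}. continuous (at (x h) within {a..b}) f"
    have "has_rs_integral f (continuous_part F (x (h - 1)) (x h)) (x (h - 1)) (x h) 0"
      if "h \<in> {1..p+1}" for h
      using continuous_part_constant[OF piece[OF that]] const that
      by (metis has_rs_integral_const)
    from main[OF contf this]
    have int: "has_rs_integral f F a b
        ((right_lim F a - F a) * f a + (F b - left_lim F b) * f b
         + (\<Sum>h=1..p. jump F (x h) * f (x h)))"
      by (simp add: Fa Fb)
    then show "\<forall>l y c. rs_sequence a b l y c \<longrightarrow>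
         (\<lambda>n. rs_sum f F (l n) (y n) (c n)) \<longlonglongrightarrow>
           (right_lim F a - F a) * f a + (F b - left_lim F b) * f b
           + (\<Sum>h=1..p. jump F (x h) * f (x h))"
      by (simp add: has_rs_integral_def)
    show "rs_integrable f F a b"
      using int by (auto simp: rs_integrable_def)
    show "rs_integral f F a b = (right_lim F a - F a) * f a + (F b - left_lim F b) * f b
         + (\<Sum>h=1..p. jump F (x h) * f (x h))"
      by (rule rs_integral_eqI[OF assms(1) int])
  next
    assume contf: "\<forall>h\<in>{1..p}. continuous (at (x h) within {a..b}) f"
      and pieces: "\<forall>h\<in>{1..p+1}.
         rs_integrable f (continuous_part F (x (h - 1)) (x h)) (x (h - 1)) (x h)"
    have int: "has_rs_integral f F a b ((\<Sum>h=1..p. jump F (x h) * f (x h))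
        + (\<Sum>h=1..p+1.
             rs_integral f (continuous_part F (x (h - 1)) (x h)) (x (h - 1)) (x h)))"
      using pieces piece by (intro main[OF contf] rs_integrable_imp_has_rs_integral) auto
    then show "rs_integrable f F a b"
      by (auto simp: rs_integrable_def)
    show "rs_integral f F a b =
        (right_lim F a - F a) * f a + (F b - left_lim F b) * f b
        + (\<Sum>h=1..p. jump F (x h) * f (x h))
        + (\<Sum>h=1..p+1.
             rs_integral f (continuous_part F (x (h - 1)) (x h)) (x (h - 1)) (x h))"
      unfolding rs_integral_eqI[OF assms(1) int] by (simp add: Fa Fb)
  qed
qed

end
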